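(* Let $G$ be a minimal locally compact groupoid with compact metrizable unit space $X$, let $E$ be a (continuous) $G$-Hilbert bundle over $X$, with linear action denoted by $L$, and let $c:G\to r^*E$ be a continuous cocycle. Assume that the bundle space $E$ is second countable. Then the following properties are equivalent: (i) $c$ is a continuous coboundary, i.e. there exists a continuous section $f:X\to E$ such that $c(\gamma)=f(r(\gamma))-L(\gamma)f(s(\gamma))$ for all $\gamma\in G$; (ii) there exists $x\in X$ such that $\{\|c(\gamma)\| : \gamma\in G,\ s(\gamma)=x\}$ is bounded; (iii) $\{\|c(\gamma)\|:\gamma\in G\}$ is bounded.
   Context: Compact means quasi-compact and Hausdorff; locally compact means that each point has a compact neighborhood (a locally compact space need not be Hausdorff). Hilbert bundle: Let $X$ be a topological space. A Hilbert bundle over $X$ is a topological space $E$ with a continuous open surjection $\pi:E\to X$, together with operations and scalar products making each fiber $E_x=\pi^{-1}(x)$ a complex Hilbert space (scalar product $(u|v)$ linear in the second variable, norm $\|u\|$), such that (1) $u\mapsto\|u\|$ is continuous on $E$; (2) addition is continuous from $\{(u,v)\in E\times E:\pi(u)=\pi(v)\}$ to $E$; (3) for each scalar $\lambda$, $u\mapsto\lambda u$ is continuous on $E$; (4) if $x\in X$ and $(u_i)$ is a net in $E$ with $\|u_i\|\to0$ and $\pi(u_i)\to x$, then $u_i\to 0_x$, the zero element of $E_x$. A section is a map $f:X\to E$ with $f(x)\in E_x$ for all $x$. Groupoids: a topological groupoid $G$ has unit space $X$, range and source maps $r,s:G\to X$, which are assumed to be open. A subset $U\subset X$ is invariant if $s(\gamma)\in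 U$ implies $r(\gamma)\in U$. $G$ is minimal if $\emptyset$ and $X$ are the only open invariant subsets of $X$. A $G$-Hilbert bundle is a Hilbert bundle $\pi:E\to X$ over the unit space $X$ of $G$ with a continuous groupoid action $G*E\to E$, $(\gamma,u)\mapsto L(\gamma)u$, where $G*E=\{(\gamma,u)\in G\times E:s(\gamma)=\pi(u)\}$, such that for every $\gamma\in G$, $L(\gamma):E_{s(\gamma)}\to E_{r(\gamma)}$ is a linear isometry (in particular $L(\gamma\gamma')=L(\gamma)L(\gamma')$ for composable pairs and units act as identities). A continuous cocycle $c:G\to r^*E$ is a continuous map assigning to each $\gamma\in G$ an element $c(\gamma)\in E_{r(\gamma)}$ such that $c(\gamma\gamma')=c(\gamma)+L(\gamma)c(\gamma')$ for all composable pairs $(\gamma,\gamma')$. *)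

theory Defs
  imports "HOL-Analysis.Analysis"
begin

text \<open>The spaces of arrows, of units and of a bundle are whole types of class
  \<open>topological_space\<close>. Operations that are partial in the mathematics (multiplication of
  arrows, addition in a fibre, the action) are total functions that are constrained only on
  their domain.\<close>

text \<open>Here a compact set is quasi-compact and Hausdorff, so local compactness gives every point
  a Hausdorff neighbourhood, although the whole space need not be Hausdorff. The library's
  \<open>locally_compact_space\<close> lacks the Hausdorff condition.\<close>

definition locally_compact_locally_Hausdorff :: "'a topology \<Rightarrow> bool" where
  "locally_compact_locally_Hausdorff T \<longleftrightarrow>
     (\<forall>x \<in> topspace T. \<exists>U K. openin T U \<and> x \<in> U \<and> U \<subseteq> K \<and>
        compactin T K \<and> Hausdorff_space (subtopology T K))"


text \<open>The unit space is a type of its own, embedded in the arrows by \<open>unit_of\<close>; in a topological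
  groupoid \<open>unit_of\<close> is continuous with continuous left inverse \<open>r\<close>, hence a homeomorphism onto
  the set of units. The product \<open>gmult \<gamma> \<gamma>'\<close> is meaningful when \<open>s \<gamma> = r \<gamma>'\<close>.\<close>

locale groupoid =
  fixes r s :: "'g \<Rightarrow> 'x"
    and unit_of :: "'x \<Rightarrow> 'g"
    and gmult :: "'g \<Rightarrow> 'g \<Rightarrow> 'g"
    and ginv :: "'g \<Rightarrow> 'g"
  assumes r_unit: "r (unit_of x) = x"
    and s_unit: "s (unit_of x) = x"
    and r_mult: "s \<gamma> = r \<gamma>' \<Longrightarrow> r (gmult \<gamma> \<gamma>') = r \<gamma>"
    and s_mult: "s \<gamma> = r \<gamma>' \<Longrightarrow> s (gmult \<gamma> \<gamma>') = s \<gamma>'"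
    and mult_assoc: "s \<gamma> = r \<gamma>' \<Longrightarrow> s \<gamma>' = r \<gamma>'' \<Longrightarrow>
           gmult (gmult \<gamma> \<gamma>') \<gamma>'' = gmult \<gamma> (gmult \<gamma>' \<gamma>'')"
    and unit_left: "gmult (unit_of (r \<gamma>)) \<gamma> = \<gamma>"
    and unit_right: "gmult \<gamma> (unit_of (s \<gamma>)) = \<gamma>"
    and r_inv: "r (ginv \<gamma>) = s \<gamma>"
    and s_inv: "s (ginv \<gamma>) = r \<gamma>"
    and inv_left: "gmult (ginv \<gamma>) \<gamma> = unit_of (s \<gamma>)"
    and inv_right: "gmult \<gamma> (ginv \<gamma>) = unit_of (r \<gamma>)"

locale topological_groupoid = groupoid r s unit_of gmult ginv
  for r s :: "'g::topological_space \<Rightarrow> 'x::topological_space"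
    and unit_of :: "'x \<Rightarrow> 'g"
    and gmult :: "'g \<Rightarrow> 'g \<Rightarrow> 'g"
    and ginv :: "'g \<Rightarrow> 'g" +
  assumes continuous_r: "continuous_on UNIV r"
    and continuous_s: "continuous_on UNIV s"
    and continuous_unit: "continuous_on UNIV unit_of"
    and continuous_mult: "continuous_on {(\<gamma>, \<gamma>'). s \<gamma> = r \<gamma>'} (\<lambda>(\<gamma>, \<gamma>'). gmult \<gamma> \<gamma>')"
    and continuous_inv: "continuous_on UNIV ginv"
    and open_r: "open U \<Longrightarrow> open (r ` U)"
    and open_s: "open U \<Longrightarrow> open (s ` U)"

definition groupoid_invariant :: "('g \<Rightarrow> 'x) \<Rightarrow> ('g \<Rightarrow> 'x) \<Rightarrow> 'x set \<Rightarrow> bool" where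
  "groupoid_invariant r s U \<longleftrightarrow> (\<forall>\<gamma>. s \<gamma> \<in> U \<longrightarrow> r \<gamma> \<in> U)"

definition groupoid_minimal :: "('g \<Rightarrow> 'x::topological_space) \<Rightarrow> ('g \<Rightarrow> 'x) \<Rightarrow> bool" where
  "groupoid_minimal r s \<longleftrightarrow>
     (\<forall>U. open U \<and> groupoid_invariant r s U \<longrightarrow> U = {} \<or> U = UNIV)"


text \<open>No complex Hilbert space structure is available in the imported library, and the spaces
  needed here are fibres, that is, subsets of a type. The scalar product is linear in the second
  variable.\<close>

definition ip_norm :: "('e \<Rightarrow> 'e \<Rightarrow> complex) \<Rightarrow> 'e \<Rightarrow> real" where
  "ip_norm ip u = sqrt (Re (ip u u))"

definition vec_diff :: "('e \<Rightarrow> 'e \<Rightarrow> 'e) \<Rightarrow> (complex \<Rightarrow> 'e \<Rightarrow> 'e) \<Rightarrow> 'e \<Rightarrow> 'e \<Rightarrow> 'e" where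
  "vec_diff add smul u v = add u (smul (- 1) v)"

locale complex_hilbert_space_on =
  fixes H :: "'e set"
    and add :: "'e \<Rightarrow> 'e \<Rightarrow> 'e"
    and z :: 'e
    and smul :: "complex \<Rightarrow> 'e \<Rightarrow> 'e"
    and ip :: "'e \<Rightarrow> 'e \<Rightarrow> complex"
  assumes add_closed: "u \<in> H \<Longrightarrow> v \<in> H \<Longrightarrow> add u v \<in> H"
    and zero_closed: "z \<in> H"
    and scale_closed: "u \<in> H \<Longrightarrow> smul a u \<in> H"
    and add_assoc: "u \<in> H \<Longrightarrow> v \<in> H \<Longrightarrow> w \<in> H \<Longrightarrow> add (add u v) w = add u (add v w)"
    and add_commute: "u \<in> H \<Longrightarrow> v \<in> H \<Longrightarrow> add u v = add v u"
    and add_zero: "u \<in> H \<Longrightarrow> add u z = u"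
    and add_inverse: "u \<in> H \<Longrightarrow> \<exists>v \<in> H. add u v = z"
    and scale_add_right: "u \<in> H \<Longrightarrow> v \<in> H \<Longrightarrow> smul a (add u v) = add (smul a u) (smul a v)"
    and scale_add_left: "u \<in> H \<Longrightarrow> smul (a + b) u = add (smul a u) (smul b u)"
    and scale_scale: "u \<in> H \<Longrightarrow> smul a (smul b u) = smul (a * b) u"
    and scale_one: "u \<in> H \<Longrightarrow> smul 1 u = u"
    and ip_add_right: "u \<in> H \<Longrightarrow> v \<in> H \<Longrightarrow> w \<in> H \<Longrightarrow> ip u (add v w) = ip u v + ip u w"
    and ip_scale_right: "u \<in> H \<Longrightarrow> v \<in> H \<Longrightarrow> ip u (smul a v) = a * ip u v"
    and ip_commute: "u \<in> H \<Longrightarrow> v \<in> H \<Longrightarrow> ip v u = cnj (ip u v)"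
    and ip_pos: "u \<in> H \<Longrightarrow> u \<noteq> z \<Longrightarrow> 0 < Re (ip u u)"
    and complete: "(\<And>n. S n \<in> H) \<Longrightarrow>
          (\<forall>\<epsilon>>0. \<exists>N. \<forall>m\<ge>N. \<forall>n\<ge>N. ip_norm ip (vec_diff add smul (S m) (S n)) < \<epsilon>) \<Longrightarrow>
          \<exists>l \<in> H. (\<lambda>n. ip_norm ip (vec_diff add smul (S n) l)) \<longlonglongrightarrow> 0"


text \<open>The axiom \<open>tendsto_zero\<close> is stated with filters on the bundle space instead of nets: a net
  converges exactly when its filter of tails does.\<close>

locale hilbert_bundle =
  fixes p :: "'e::topological_space \<Rightarrow> 'x::topological_space"
    and add :: "'e \<Rightarrow> 'e \<Rightarrow> 'e"
    and zero :: "'x \<Rightarrow> 'e"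
    and smul :: "complex \<Rightarrow> 'e \<Rightarrow> 'e"
    and ip :: "'e \<Rightarrow> 'e \<Rightarrow> complex"
  assumes continuous_proj: "continuous_on UNIV p"
    and open_proj: "open U \<Longrightarrow> open (p ` U)"
    and surj_proj: "surj p"
    and hilbert_fibre: "complex_hilbert_space_on (p -` {x}) add (zero x) smul ip"
    and continuous_norm: "continuous_on UNIV (ip_norm ip)"
    and continuous_add: "continuous_on {(u, v). p u = p v} (\<lambda>(u, v). add u v)"
    and continuous_scale: "continuous_on UNIV (smul a)"
    and tendsto_zero: "(ip_norm ip \<longlongrightarrow> 0) F \<Longrightarrow> (p \<longlongrightarrow> x) F \<Longrightarrow> ((\<lambda>u. u) \<longlongrightarrow> zero x) F"

locale G_hilbert_bundle =
  topological_groupoid r s unit_of gmult ginv + hilbert_bundle p add zero smul ip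
  for r s :: "'g::topological_space \<Rightarrow> 'x::topological_space"
    and unit_of :: "'x \<Rightarrow> 'g"
    and gmult :: "'g \<Rightarrow> 'g \<Rightarrow> 'g"
    and ginv :: "'g \<Rightarrow> 'g"
    and p :: "'e::topological_space \<Rightarrow> 'x"
    and add :: "'e \<Rightarrow> 'e \<Rightarrow> 'e"
    and zero :: "'x \<Rightarrow> 'e"
    and smul :: "complex \<Rightarrow> 'e \<Rightarrow> 'e"
    and ip :: "'e \<Rightarrow> 'e \<Rightarrow> complex" +
  fixes L :: "'g \<Rightarrow> 'e \<Rightarrow> 'e"
  assumes action_fibre: "s \<gamma> = p u \<Longrightarrow> p (L \<gamma> u) = r \<gamma>"
    and action_unit: "L (unit_of (p u)) u = u"
    and action_mult: "s \<gamma> = r \<gamma>' \<Longrightarrow> s \<gamma>' = p u \<Longrightarrow> L (gmult \<gamma> \<gamma>') u = L \<gamma> (L \<gamma>' u)"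
    and action_add: "s \<gamma> = p u \<Longrightarrow> s \<gamma> = p v \<Longrightarrow> L \<gamma> (add u v) = add (L \<gamma> u) (L \<gamma> v)"
    and action_scale: "s \<gamma> = p u \<Longrightarrow> L \<gamma> (smul a u) = smul a (L \<gamma> u)"
    and action_isometry: "s \<gamma> = p u \<Longrightarrow> ip_norm ip (L \<gamma> u) = ip_norm ip u"
    and continuous_action: "continuous_on {(\<gamma>, u). s \<gamma> = p u} (\<lambda>(\<gamma>, u). L \<gamma> u)"

text \<open>Continuity into the pullback \<open>r\<^sup>*E \<subseteq> G \<times> E\<close> of the map \<open>\<gamma> \<mapsto> (\<gamma>, c \<gamma>)\<close> is
  continuity of \<open>c\<close> into \<open>E\<close>.\<close>

definition continuous_cocycle ::
  "('g::topological_space \<Rightarrow> 'x) \<Rightarrow> ('g \<Rightarrow> 'x) \<Rightarrow> ('g \<Rightarrow> 'g \<Rightarrow> 'g) \<Rightarrow>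
   ('e::topological_space \<Rightarrow> 'x) \<Rightarrow> ('e \<Rightarrow> 'e \<Rightarrow> 'e) \<Rightarrow> ('g \<Rightarrow> 'e \<Rightarrow> 'e) \<Rightarrow> ('g \<Rightarrow> 'e) \<Rightarrow> bool" where
  "continuous_cocycle r s gmult p add L c \<longleftrightarrow>
     continuous_on UNIV c \<and> (\<forall>\<gamma>. p (c \<gamma>) = r \<gamma>) \<and>
     (\<forall>\<gamma> \<gamma>'. s \<gamma> = r \<gamma>' \<longrightarrow> c (gmult \<gamma> \<gamma>') = add (c \<gamma>) (L \<gamma> (c \<gamma>')))"

definition continuous_section ::
  "('e::topological_space \<Rightarrow> 'x::topological_space) \<Rightarrow> ('x \<Rightarrow> 'e) \<Rightarrow> bool" where
  "continuous_section p f \<longleftrightarrow> continuous_on UNIV f \<and> (\<forall>x. p (f x) = x)"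

definition continuous_coboundary ::
  "('g \<Rightarrow> 'x::topological_space) \<Rightarrow> ('g \<Rightarrow> 'x) \<Rightarrow> ('e::topological_space \<Rightarrow> 'x) \<Rightarrow>
   ('e \<Rightarrow> 'e \<Rightarrow> 'e) \<Rightarrow> (complex \<Rightarrow> 'e \<Rightarrow> 'e) \<Rightarrow> ('g \<Rightarrow> 'e \<Rightarrow> 'e) \<Rightarrow> ('g \<Rightarrow> 'e) \<Rightarrow> bool" where
  "continuous_coboundary r s p add smul L c \<longleftrightarrow>
     (\<exists>f. continuous_section p f \<and>
        (\<forall>\<gamma>. c \<gamma> = vec_diff add smul (f (r \<gamma>)) (L \<gamma> (f (s \<gamma>)))))"

end

theory Submission
  imports Defs
begin

text \<open>A bounded cocycle makes \<open>G\<close> act on \<open>E\<close> by the affine isometries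
  \<open>u \<mapsto> L(\<gamma>)u + c(\<gamma>)\<close>, which permute the bounded sets \<open>C\<^sub>x = {c(\<gamma>) | r(\<gamma>) = x}\<close>. The value
  \<open>f(x)\<close> is the Chebyshev centre of \<open>C\<^sub>x\<close>, obtained from the dual description: consider
  probability measures of finite support on \<open>C\<^sub>x\<close>, and let \<open>V\<close> be the supremum of their variances.
  As \<open>r\<close> is open, such a measure can be moved continuously to nearby fibres, so \<open>V\<close> is lower
  semicontinuous in \<open>x\<close>; it is also invariant, hence constant by minimality. The midpoint of two
  measures with barycentres \<open>b\<close>, \<open>b'\<close> has variance \<open>(v + v')/2 + \<parallel>b - b'\<parallel>\<^sup>2/4 \<le> V\<close>, so barycentres of
  measures of nearly maximal variance are close together, and they converge to \<open>f(x)\<close>. Since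
  \<open>V\<close> is constant, a nearly maximal measure at \<open>x\<close> remains nearly maximal when moved to nearby
  fibres, and its barycentre stays close to \<open>f\<close>; this gives norm continuity of \<open>f\<close>
  without weak topologies or a Baire argument.

  A bound on one fibre \<open>s(\<gamma>) = x\<close> is a bound on all of them because the saturation of the open set
  \<open>s({\<gamma> | \<parallel>c(\<gamma>)\<parallel> > 2M})\<close> is open and invariant and avoids \<open>x\<close>.\<close>

section \<open>Vector algebra and squared norms in one Hilbert space\<close>

context complex_hilbert_space_on
begin

abbreviation normsq :: "'e \<Rightarrow> real" where
  "normsq u \<equiv> (ip_norm ip u)\<^sup>2"

abbreviation diff :: "'e \<Rightarrow> 'e \<Rightarrow> 'e" where
  "diff u v \<equiv> vec_diff add smul u v"

definition mid :: "'e \<Rightarrow> 'e \<Rightarrow> 'e" where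
  "mid u v = smul (1/2) (add u v)"

lemma diff_closed: "u \<in> H \<Longrightarrow> v \<in> H \<Longrightarrow> diff u v \<in> H"
  by (simp add: vec_diff_def add_closed scale_closed)

lemma mid_closed: "u \<in> H \<Longrightarrow> v \<in> H \<Longrightarrow> mid u v \<in> H"
  by (simp add: mid_def add_closed scale_closed)

lemma add_left_commute:
  "u \<in> H \<Longrightarrow> v \<in> H \<Longrightarrow> w \<in> H \<Longrightarrow> add u (add v w) = add v (add u w)"
  by (metis add_assoc add_commute)

lemma zero_add: "u \<in> H \<Longrightarrow> add z u = u"
  by (metis add_commute add_zero zero_closed)

lemma add_left_cancel:
  assumes "u \<in> H" "v \<in> H" "w \<in> H" "add u v = add u w"
  shows "v = w"
  by (metis assms add_assoc add_commute add_inverse zero_add)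

lemma scale_zero: "u \<in> H \<Longrightarrow> smul 0 u = z"
  by (metis add_left_cancel add_zero scale_add_left scale_closed zero_closed add.right_neutral)

lemma add_minus_self: "u \<in> H \<Longrightarrow> add u (smul (- 1) u) = z"
  by (metis scale_add_left scale_one scale_zero add.right_inverse)

lemma add_diff_cancel: "u \<in> H \<Longrightarrow> v \<in> H \<Longrightarrow> add v (diff u v) = u"
  by (metis add_left_commute add_minus_self add_zero scale_closed vec_diff_def)

text \<open>Reduces identities between differences to identities between sums.\<close>

lemma diff_unique:
  assumes "u \<in> H" "v \<in> H" "w \<in> H" "add v w = u"
  shows "w = diff u v"
  by (metis assms add_diff_cancel add_left_cancel diff_closed)

lemma diff_add_right:
  assumes "a \<in> H" "b \<in> H" "w \<in> H"
  shows "diff (add a w) (add b w) = diff a b"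
proof -
  have "add (add b w) (diff a b) = add w (add b (diff a b))"
    using assms by (metis add_assoc add_commute diff_closed)
  then have "add (add b w) (diff a b) = add a w"
    using assms by (simp add: add_diff_cancel add_commute)
  then show ?thesis
    using assms diff_unique[of "add a w" "add b w" "diff a b"] by (simp add: add_closed diff_closed)
qed

lemma diff_diff:
  assumes "a \<in> H" "b \<in> H" "w \<in> H"
  shows "add (diff a b) (diff b w) = diff a w"
proof -
  have "add w (add (diff a b) (diff b w)) = add (diff a b) (add w (diff b w))"
    using assms by (simp add: add_left_commute diff_closed)
  also have "\<dots> = a"
    using assms by (simp add: add_diff_cancel add_commute diff_closed)
  finally show ?thesis
    using assms by (simp add: add_closed diff_closed diff_unique)
qed

text \<open>Since \<open>w\<close> is the midpoint of \<open>w\<close> and itself, translations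
  respect midpoints; hence so do affine maps.\<close>

lemma mid_add_right:
  assumes "a \<in> H" "b \<in> H" "w \<in> H"
  shows "mid (add a w) (add b w) = add (mid a b) w"
proof -
  have "add (add a w) (add b w) = add (add a b) (add w w)"
    using assms by (simp add: add_assoc add_left_commute add_closed)
  moreover have "smul (1/2) (add w w) = w"
    using assms(3) scale_add_left[of w "1/2" "1/2"] by (simp add: scale_add_right scale_one)
  ultimately show ?thesis
    using assms by (simp add: mid_def scale_add_right add_closed)
qed

lemma ip_add_left: "u \<in> H \<Longrightarrow> v \<in> H \<Longrightarrow> w \<in> H \<Longrightarrow> ip (add u v) w = ip u w + ip v w"
  by (metis ip_commute ip_add_right add_closed complex_cnj_add)

lemma ip_scale_left: "u \<in> H \<Longrightarrow> v \<in> H \<Longrightarrow> ip (smul a u) v = cnj a * ip u v"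
  by (metis ip_commute ip_scale_right scale_closed complex_cnj_mult)

lemma ip_zero: "ip z z = 0"
  by (metis ip_scale_right scale_zero zero_closed mult_zero_left)

lemma ip_self_nonneg: "u \<in> H \<Longrightarrow> 0 \<le> Re (ip u u)"
  by (metis ip_pos ip_zero order_less_imp_le order_refl zero_complex.simps(1))

lemma normsq_eq: "u \<in> H \<Longrightarrow> normsq u = Re (ip u u)"
  by (simp add: ip_norm_def ip_self_nonneg)

lemma normsq_eq_0: "u \<in> H \<Longrightarrow> normsq u = 0 \<Longrightarrow> u = z"
  using ip_pos normsq_eq by fastforce

lemma normsq_scale: "u \<in> H \<Longrightarrow> normsq (smul a u) = (cmod a)\<^sup>2 * normsq u"
proof -
  assume u: "u \<in> H"
  have "ip (smul a u) (smul a u) = complex_of_real ((cmod a)\<^sup>2) * ip u u"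
    using u by (simp add: ip_scale_left ip_scale_right scale_closed complex_norm_square
        mult_ac del: of_real_power)
  then show ?thesis
    using u by (simp add: normsq_eq scale_closed del: of_real_power)
qed

lemma normsq_add:
  assumes "u \<in> H" "v \<in> H"
  shows "normsq (add u v) = normsq u + normsq v + 2 * Re (ip u v)"
proof -
  have "ip v u = cnj (ip u v)"
    using assms by (rule ip_commute)
  then show ?thesis
    using assms by (simp add: normsq_eq add_closed ip_add_left ip_add_right)
qed

lemma normsq_diff:
  assumes "u \<in> H" "v \<in> H"
  shows "normsq (diff u v) = normsq u + normsq v - 2 * Re (ip u v)"
  using assms by (simp add: vec_diff_def normsq_add scale_closed normsq_scale ip_scale_right)

text \<open>The parallelogram law, arranged so that it gives the variance of an average of two
  measures.\<close>

lemma normsq_mid: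
  assumes "u \<in> H" "v \<in> H"
  shows "normsq (mid u v) + normsq (diff u v) / 4 = (normsq u + normsq v) / 2"
  using assms by (simp add: mid_def normsq_scale add_closed normsq_add normsq_diff
      norm_divide power_divide field_simps)

text \<open>The parallelogram law with the term \<open>normsq (diff u v)\<close> dropped. It serves
  as a triangle inequality for squared norms, at the cost of a factor 2.\<close>

lemma normsq_add_le:
  assumes "u \<in> H" "v \<in> H"
  shows "normsq (add u v) \<le> 2 * normsq u + 2 * normsq v"
proof -
  have "0 \<le> normsq (diff u v)" by simp
  then show ?thesis
    using assms by (simp add: normsq_add normsq_diff)
qed

lemma normsq_diff_le:
  assumes "u \<in> H" "v \<in> H"
  shows "normsq (diff u v) \<le> 2 * normsq u + 2 * normsq v"
proof -
  have "0 \<le> normsq (add u v)" by simp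
  then show ?thesis
    using assms by (simp add: normsq_add normsq_diff)
qed

lemma normsq_diff_commute: "u \<in> H \<Longrightarrow> v \<in> H \<Longrightarrow> normsq (diff u v) = normsq (diff v u)"
  using ip_commute[of u v] by (simp add: normsq_diff)

lemma normsq_diff_triangle:
  assumes "a \<in> H" "b \<in> H" "w \<in> H"
  shows "normsq (diff a w) \<le> 2 * normsq (diff a b) + 2 * normsq (diff b w)"
  using normsq_add_le[of "diff a b" "diff b w"] assms by (simp add: diff_closed diff_diff)

text \<open>The bound \<open>e m + e n\<close> is the shape in which the variance estimate for
  barycentres arrives.\<close>

lemma normsq_complete:
  assumes S: "\<And>n. S n \<in> H"
    and bound: "\<And>m n. normsq (diff (S m) (S n)) \<le> e m + e n"
    and e: "e \<longlonglongrightarrow> 0"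
  obtains l where "l \<in> H" "(\<lambda>n. normsq (diff (S n) l)) \<longlonglongrightarrow> 0"
proof -
  have "\<exists>N. \<forall>m\<ge>N. \<forall>n\<ge>N. ip_norm ip (diff (S m) (S n)) < \<epsilon>" if "\<epsilon> > 0" for \<epsilon>
  proof -
    have "\<forall>\<^sub>F n in sequentially. e n < \<epsilon>\<^sup>2 / 2"
      using e \<open>\<epsilon> > 0\<close> by (intro order_tendstoD) auto
    then obtain N where N: "\<And>n. n \<ge> N \<Longrightarrow> e n < \<epsilon>\<^sup>2 / 2"
      by (auto simp: eventually_sequentially)
    have "ip_norm ip (diff (S m) (S n)) < \<epsilon>" if "m \<ge> N" "n \<ge> N" for m n
    proof (rule power2_less_imp_less)
      show "normsq (diff (S m) (S n)) < \<epsilon>\<^sup>2"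
        using bound[of m n] N[OF that(1)] N[OF that(2)] by linarith
    qed (use \<open>\<epsilon> > 0\<close> in simp)
    then show ?thesis by blast
  qed
  then have "\<exists>l\<in>H. (\<lambda>n. ip_norm ip (diff (S n) l)) \<longlonglongrightarrow> 0"
    by (intro complete[OF S]) blast
  then obtain l where l: "l \<in> H" "(\<lambda>n. ip_norm ip (diff (S n) l)) \<longlonglongrightarrow> 0"
    by (elim bexE)
  have "(\<lambda>n. normsq (diff (S n) l)) \<longlonglongrightarrow> 0"
    using tendsto_power[OF l(2), of 2] by simp
  with l(1) show ?thesis
    by (rule that)
qed

end

section \<open>Neighbourhoods in the total space of a Hilbert bundle\<close>

context hilbert_bundle
begin

sublocale fibre: complex_hilbert_space_on "p -` {x}" add "zero x" smul ip for x
  by (rule hilbert_fibre)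

abbreviation normsq :: "'e \<Rightarrow> real" where
  "normsq u \<equiv> (ip_norm ip u)\<^sup>2"

abbreviation diff :: "'e \<Rightarrow> 'e \<Rightarrow> 'e" where
  "diff u v \<equiv> vec_diff add smul u v"

text \<open>The midpoint depends on the operations only and not on the carrier, so one function
  serves all fibres.\<close>

abbreviation mid :: "'e \<Rightarrow> 'e \<Rightarrow> 'e" where
  "mid \<equiv> complex_hilbert_space_on.mid add smul"

lemma proj_zero [simp]: "p (zero x) = x"
  using fibre.zero_closed[of x] by simp

lemma proj_add [simp]: "p u = x \<Longrightarrow> p v = x \<Longrightarrow> p (add u v) = x"
  using fibre.add_closed[of u x v] by simp

lemma proj_scale [simp]: "p (smul a u) = p u"
  using fibre.scale_closed[of u "p u" a] by simp

lemma proj_diff [simp]: "p u = x \<Longrightarrow> p v = x \<Longrightarrow> p (diff u v) = x"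
  by (simp add: vec_diff_def)

lemma proj_mid [simp]: "p u = x \<Longrightarrow> p v = x \<Longrightarrow> p (mid u v) = x"
  using fibre.mid_closed[of u x v] by simp

text \<open>Continuity on the fibred product only controls pairs over a common base point, hence the
  condition \<open>p u' = p v'\<close>.\<close>

lemma open_add_nhds:
  assumes "open W" "add u v \<in> W" "p u = p v"
  obtains A B where "open A" "open B" "u \<in> A" "v \<in> B"
    "\<And>u' v'. u' \<in> A \<Longrightarrow> v' \<in> B \<Longrightarrow> p u' = p v' \<Longrightarrow> add u' v' \<in> W"
proof -
  obtain T where T: "open T"
    "T \<inter> {(u, v). p u = p v} = (\<lambda>(u, v). add u v) -` W \<inter> {(u, v). p u = p v}"
    using continuous_add \<open>open W\<close> unfolding continuous_on_open_invariant by blast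
  have "(u, v) \<in> T"
    using T(2) assms by auto
  then obtain A B where AB: "open A" "open B" "(u, v) \<in> A \<times> B" "A \<times> B \<subseteq> T"
    using T(1) open_prod_elim by blast
  have "add u' v' \<in> W" if "u' \<in> A" "v' \<in> B" "p u' = p v'" for u' v'
  proof -
    have "(u', v') \<in> T \<inter> {(u, v). p u = p v}"
      using AB(4) that by auto
    then show ?thesis
      unfolding T(2) by auto
  qed
  then show ?thesis
    using that AB by auto
qed

lemma open_scale_vimage: "open W \<Longrightarrow> open (smul a -` W)"
  using continuous_scale by (simp add: continuous_on_open_vimage)

lemma open_mid_nhds:
  assumes "open W" "mid u v \<in> W" "p u = p v"
  obtains A B where "open A" "open B" "u \<in> A" "v \<in> B"
    "\<And>u' v'. u' \<in> A \<Longrightarrow> v' \<in> B \<Longrightarrow> p u' = p v' \<Longrightarrow> mid u' v' \<in> W"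
  using open_add_nhds[OF open_scale_vimage[OF assms(1), of "1/2"], of u v] assms
  by (auto simp: fibre.mid_def)

lemma open_diff_nhds:
  assumes "open W" "diff u v \<in> W" "p u = p v"
  obtains A B where "open A" "open B" "u \<in> A" "v \<in> B"
    "\<And>u' v'. u' \<in> A \<Longrightarrow> v' \<in> B \<Longrightarrow> p u' = p v' \<Longrightarrow> diff u' v' \<in> W"
proof -
  obtain A B where "open A" "open B" "u \<in> A" "smul (- 1) v \<in> B"
    "\<And>u' v'. u' \<in> A \<Longrightarrow> v' \<in> B \<Longrightarrow> p u' = p v' \<Longrightarrow> add u' v' \<in> W"
    using open_add_nhds[OF assms(1), of u "smul (- 1) v"] assms(2,3)
    by (metis proj_scale vec_diff_def)
  then show ?thesis
    using that[of A "smul (- 1) -` B"] by (auto simp: open_scale_vimage vec_diff_def)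
qed

lemma open_normsq_gt: "open {u. t < normsq u}"
  using continuous_norm by (intro open_Collect_less continuous_intros)

text \<open>The convergence axiom \<open>tendsto_zero\<close> recast as a statement about
  neighbourhoods: small vectors over points near \<open>x\<close> are close to
  \<open>zero x\<close>.\<close>

lemma zero_nhds:
  assumes "open B" "zero x \<in> B"
  obtains O' \<epsilon> where "open O'" "x \<in> O'" "\<epsilon> > 0" "\<And>w. p w \<in> O' \<Longrightarrow> normsq w < \<epsilon> \<Longrightarrow> w \<in> B"
proof -
  \<comment> \<open>The coarsest filter along which the norm tends to 0 and \<open>p\<close> tends
    to \<open>x\<close>.\<close>
  define F where "F = inf (filtercomap (ip_norm ip) (nhds 0)) (filtercomap p (nhds x))"
  have "((\<lambda>u. u) \<longlongrightarrow> zero x) F"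
  proof (rule tendsto_zero)
    show "(ip_norm ip \<longlongrightarrow> 0) F"
      by (metis F_def filterlim_filtercomap filterlim_mono inf_le1 order_refl)
    show "(p \<longlongrightarrow> x) F"
      by (metis F_def filterlim_filtercomap filterlim_mono inf_le2 order_refl)
  qed
  then have "\<forall>\<^sub>F w in F. w \<in> B"
    using assms by (rule topological_tendstoD)
  then obtain Q R where Q: "\<forall>\<^sub>F t in nhds (0::real). Q t" and R: "\<forall>\<^sub>F y in nhds x. R y"
    and QR: "\<And>w. Q (ip_norm ip w) \<Longrightarrow> R (p w) \<Longrightarrow> w \<in> B"
    unfolding F_def eventually_inf eventually_filtercomap by metis
  obtain d where d: "d > 0" "\<And>t. dist t 0 < d \<Longrightarrow> Q t"
    using Q unfolding eventually_nhds_metric by blast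
  obtain O' where O': "open O'" "x \<in> O'" "\<And>y. y \<in> O' \<Longrightarrow> R y"
    using R unfolding eventually_nhds by blast
  have "w \<in> B" if "p w \<in> O'" "normsq w < d\<^sup>2" for w
  proof (rule QR)
    have "\<bar>ip_norm ip w\<bar> < d"
      using that(2) d(1) by (metis abs_of_pos power2_less_imp_less power2_abs abs_ge_zero less_imp_le)
    then show "Q (ip_norm ip w)"
      by (intro d(2)) simp
    show "R (p w)"
      using O'(3) that(1) by simp
  qed
  then show ?thesis
    using that[OF O'(1,2), of "d\<^sup>2"] d(1) by simp
qed

text \<open>Write \<open>v\<close> as \<open>u'\<close> plus \<open>diff v u'\<close> and use
  continuity of addition at \<open>u\<close> and the zero vector. The gain is uniformity: one
  \<epsilon> works for all \<open>u'\<close> in \<open>A\<close>, across neighbouring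
  fibres.\<close>

lemma tube_nhds:
  assumes "open W" "u \<in> W"
  obtains A \<epsilon> where "open A" "u \<in> A" "\<epsilon> > 0"
    "\<And>u' v. u' \<in> A \<Longrightarrow> p v = p u' \<Longrightarrow> normsq (diff v u') < \<epsilon> \<Longrightarrow> v \<in> W"
proof -
  have "add u (zero (p u)) = u"
    by (simp add: fibre.add_zero)
  then obtain A B where AB: "open A" "open B" "u \<in> A" "zero (p u) \<in> B"
    "\<And>u' v'. u' \<in> A \<Longrightarrow> v' \<in> B \<Longrightarrow> p u' = p v' \<Longrightarrow> add u' v' \<in> W"
    using open_add_nhds[OF assms(1), of u "zero (p u)"] assms(2) by auto
  obtain O' \<epsilon> where O': "open O'" "p u \<in> O'" "\<epsilon> > 0"
    "\<And>w. p w \<in> O' \<Longrightarrow> normsq w < \<epsilon> \<Longrightarrow> w \<in> B"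
    using zero_nhds[OF AB(2,4)] by blast
  have "v \<in> W" if "u' \<in> A \<inter> p -` O'" "p v = p u'" "normsq (diff v u') < \<epsilon>" for u' v
  proof -
    have "diff v u' \<in> B"
      using that by (intro O'(4)) auto
    then have "add u' (diff v u') \<in> W"
      using that by (intro AB(5)) auto
    then show ?thesis
      using fibre.add_diff_cancel[of v "p u'" u'] that(2) by simp
  qed
  moreover have "open (A \<inter> p -` O')"
    using AB(1) O'(1) continuous_proj by (simp add: continuous_on_open_vimage open_Int)
  ultimately show ?thesis
    using that[of "A \<inter> p -` O'" \<epsilon>] AB(3) O'(2,3) by auto
qed

end

section \<open>The affine isometric action defined by a cocycle\<close>

locale bundle_cocycle = G_hilbert_bundle r s unit_of gmult ginv p add zero smul ip L
  for r s :: "'g::topological_space \<Rightarrow> 'x::topological_space"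
    and unit_of :: "'x \<Rightarrow> 'g"
    and gmult :: "'g \<Rightarrow> 'g \<Rightarrow> 'g"
    and ginv :: "'g \<Rightarrow> 'g"
    and p :: "'e::topological_space \<Rightarrow> 'x"
    and add :: "'e \<Rightarrow> 'e \<Rightarrow> 'e"
    and zero :: "'x \<Rightarrow> 'e"
    and smul :: "complex \<Rightarrow> 'e \<Rightarrow> 'e"
    and ip :: "'e \<Rightarrow> 'e \<Rightarrow> complex"
    and L :: "'g \<Rightarrow> 'e \<Rightarrow> 'e" +
  fixes c :: "'g \<Rightarrow> 'e"
  assumes cocycle: "continuous_cocycle r s gmult p add L c"
begin

lemma continuous_c: "continuous_on UNIV c"
  and proj_c [simp]: "p (c \<gamma>) = r \<gamma>"
  and c_mult: "s \<gamma> = r \<gamma>' \<Longrightarrow> c (gmult \<gamma> \<gamma>') = add (c \<gamma>) (L \<gamma> (c \<gamma>'))"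
  using cocycle unfolding continuous_cocycle_def by auto

lemma proj_action [simp]: "p u = s \<gamma> \<Longrightarrow> p (L \<gamma> u) = r \<gamma>"
  using action_fibre by simp

lemma normsq_action: "p u = s \<gamma> \<Longrightarrow> normsq (L \<gamma> u) = normsq u"
  using action_isometry by simp

lemma action_diff:
  "p u = s \<gamma> \<Longrightarrow> p v = s \<gamma> \<Longrightarrow> L \<gamma> (diff u v) = diff (L \<gamma> u) (L \<gamma> v)"
  by (simp add: vec_diff_def action_add action_scale)

lemma action_mid:
  "p u = s \<gamma> \<Longrightarrow> p v = s \<gamma> \<Longrightarrow> L \<gamma> (mid u v) = mid (L \<gamma> u) (L \<gamma> v)"
  by (simp add: fibre.mid_def action_add action_scale)

text \<open>A unit is idempotent, so its cocycle value equals twice itself; cancel.\<close>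

lemma c_unit: "c (unit_of x) = zero x"
proof -
  let ?u = "unit_of x"
  have "gmult ?u ?u = ?u"
    using unit_left[of ?u] by (simp add: r_unit)
  then have "c ?u = add (c ?u) (c ?u)"
    using c_mult[of ?u ?u] action_unit[of "c ?u"] by (simp add: r_unit s_unit)
  then have "add (c ?u) (c ?u) = add (c ?u) (zero x)"
    using fibre.add_zero[of "c ?u" x] by (simp add: r_unit)
  then show ?thesis
    using fibre.add_left_cancel[of "c ?u" x "c ?u" "zero x"] by (simp add: r_unit)
qed

text \<open>A section fixed by this action is exactly one whose coboundary is
  \<open>c\<close>.\<close>

definition affine_action :: "'g \<Rightarrow> 'e \<Rightarrow> 'e" where
  "affine_action \<gamma> u = add (L \<gamma> u) (c \<gamma>)"

lemma proj_affine [simp]: "p u = s \<gamma> \<Longrightarrow> p (affine_action \<gamma> u) = r \<gamma>"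
  by (simp add: affine_action_def)

lemma affine_c: "s \<gamma> = r \<gamma>' \<Longrightarrow> affine_action \<gamma> (c \<gamma>') = c (gmult \<gamma> \<gamma>')"
  using fibre.add_commute[of "L \<gamma> (c \<gamma>')" "r \<gamma>" "c \<gamma>"] by (simp add: affine_action_def c_mult)

lemma affine_unit: "p u = x \<Longrightarrow> affine_action (unit_of x) u = u"
  using action_unit[of u] fibre.add_zero[of u x] by (simp add: affine_action_def c_unit)

text \<open>The cocycle identity is the composition law for the translation parts.\<close>

lemma affine_mult:
  assumes "s \<gamma> = r \<gamma>'" "s \<gamma>' = p u"
  shows "affine_action (gmult \<gamma> \<gamma>') u = affine_action \<gamma> (affine_action \<gamma>' u)"
proof -
  have "affine_action \<gamma> (affine_action \<gamma>' u) = add (add (L \<gamma> (L \<gamma>' u)) (L \<gamma> (c \<gamma>'))) (c \<gamma>)"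
    using assms by (simp add: affine_action_def action_add)
  also have "\<dots> = add (L \<gamma> (L \<gamma>' u)) (add (c \<gamma>) (L \<gamma> (c \<gamma>')))"
    using assms fibre.add_assoc[of "L \<gamma> (L \<gamma>' u)" "r \<gamma>" "L \<gamma> (c \<gamma>')" "c \<gamma>"]
      fibre.add_commute[of "L \<gamma> (c \<gamma>')" "r \<gamma>" "c \<gamma>"] by simp
  finally show ?thesis
    using assms by (simp add: affine_action_def c_mult action_mult)
qed

lemma affine_affine_inv: "p u = r \<gamma> \<Longrightarrow> affine_action \<gamma> (affine_action (ginv \<gamma>) u) = u"
  using affine_mult[of \<gamma> "ginv \<gamma>" u] by (simp add: r_inv s_inv inv_right affine_unit)

lemma diff_affine:
  "p u = s \<gamma> \<Longrightarrow> p v = s \<gamma> \<Longrightarrow> diff (affine_action \<gamma> u) (affine_action \<gamma> v) = L \<gamma> (diff u v)"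
  using fibre.diff_add_right[of "L \<gamma> u" "r \<gamma>" "L \<gamma> v" "c \<gamma>"] by (simp add: affine_action_def action_diff)

lemma normsq_diff_affine:
  "p u = s \<gamma> \<Longrightarrow> p v = s \<gamma> \<Longrightarrow> normsq (diff (affine_action \<gamma> u) (affine_action \<gamma> v)) = normsq (diff u v)"
  by (simp add: diff_affine normsq_action)

lemma mid_affine:
  "p u = s \<gamma> \<Longrightarrow> p v = s \<gamma> \<Longrightarrow> affine_action \<gamma> (mid u v) = mid (affine_action \<gamma> u) (affine_action \<gamma> v)"
  using fibre.mid_add_right[of "L \<gamma> u" "r \<gamma>" "L \<gamma> v" "c \<gamma>"] by (simp add: affine_action_def action_mid)

section \<open>Bounds on cocycles, stated for squared norms\<close>

lemma bounded_norm_iff: "bounded {ip_norm ip (c \<gamma>) | \<gamma>. Q \<gamma>} \<longleftrightarrow> (\<exists>M. \<forall>\<gamma>. Q \<gamma> \<longrightarrow> normsq (c \<gamma>) \<le> M)"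
proof
  assume "bounded {ip_norm ip (c \<gamma>) | \<gamma>. Q \<gamma>}"
  then obtain M where "\<And>\<gamma>. Q \<gamma> \<Longrightarrow> \<bar>ip_norm ip (c \<gamma>)\<bar> \<le> M"
    unfolding bounded_iff by auto
  then have "\<And>\<gamma>. Q \<gamma> \<Longrightarrow> normsq (c \<gamma>) \<le> M\<^sup>2"
    by (metis abs_ge_zero power2_abs power_mono)
  then show "\<exists>M. \<forall>\<gamma>. Q \<gamma> \<longrightarrow> normsq (c \<gamma>) \<le> M" by blast
next
  assume "\<exists>M. \<forall>\<gamma>. Q \<gamma> \<longrightarrow> normsq (c \<gamma>) \<le> M"
  then obtain M where "\<And>\<gamma>. Q \<gamma> \<Longrightarrow> normsq (c \<gamma>) \<le> M" by blast
  then have "\<And>\<gamma>. Q \<gamma> \<Longrightarrow> \<bar>ip_norm ip (c \<gamma>)\<bar> \<le> sqrt M"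
    using real_le_rsqrt by (metis power2_abs)
  then show "bounded {ip_norm ip (c \<gamma>) | \<gamma>. Q \<gamma>}"
    unfolding bounded_iff by auto
qed

text \<open>A continuous section is bounded over the compact unit space, and \<open>L\<close> is
  isometric, so both terms of the coboundary are bounded.\<close>

lemma coboundary_bounded:
  assumes "compact (UNIV :: 'x set)" "continuous_coboundary r s p add smul L c"
  shows "bounded {ip_norm ip (c \<gamma>) | \<gamma>. True}"
proof -
  obtain f where f: "continuous_on UNIV f" "\<And>x. p (f x) = x"
    "\<And>\<gamma>. c \<gamma> = diff (f (r \<gamma>)) (L \<gamma> (f (s \<gamma>)))"
    using assms(2) unfolding continuous_coboundary_def continuous_section_def by blast
  have "continuous_on UNIV (\<lambda>x. ip_norm ip (f x))"
    using continuous_on_compose2[OF continuous_norm f(1)] by simp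
  then have "continuous_on UNIV (\<lambda>x. normsq (f x))"
    by (rule continuous_on_power)
  then have "bounded (range (\<lambda>x. normsq (f x)))"
    using assms(1) compact_continuous_image compact_imp_bounded by blast
  then obtain M where M: "\<And>x. normsq (f x) \<le> M"
    unfolding bounded_iff by auto
  have "normsq (c \<gamma>) \<le> 4 * M" for \<gamma>
  proof -
    have "normsq (diff (f (r \<gamma>)) (L \<gamma> (f (s \<gamma>))))
        \<le> 2 * normsq (f (r \<gamma>)) + 2 * normsq (L \<gamma> (f (s \<gamma>)))"
      using fibre.normsq_diff_le[of "f (r \<gamma>)" "r \<gamma>"] by (simp add: f(2))
    also have "\<dots> = 2 * normsq (f (r \<gamma>)) + 2 * normsq (f (s \<gamma>))"
      by (simp add: normsq_action f(2))
    also have "\<dots> \<le> 4 * M"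
      using M[of "r \<gamma>"] M[of "s \<gamma>"] by simp
    finally show ?thesis
      using f(3) by simp
  qed
  then show ?thesis
    unfolding bounded_norm_iff by blast
qed

lemma bounded_fibre_imp_bounded:
  assumes minimal: "groupoid_minimal r s"
    and bdd: "bounded {ip_norm ip (c \<gamma>) | \<gamma>. s \<gamma> = x}"
  shows "bounded {ip_norm ip (c \<gamma>) | \<gamma>. True}"
proof -
  obtain M where M: "\<And>\<gamma>. s \<gamma> = x \<Longrightarrow> normsq (c \<gamma>) \<le> M"
    using bdd unfolding bounded_norm_iff by blast
  \<comment> \<open>The threshold \<open>4 * M\<close> is what \<open>normsq_diff_le\<close> gives
    for two vectors of squared norm at most \<open>M\<close>.\<close>
  define U where "U = s ` (c -` {u. 4 * M < normsq u})"
  define Sat where "Sat = r ` (s -` U)"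
  have "open U"
    unfolding U_def by (intro open_s open_vimage open_normsq_gt continuous_c)
  then have "open Sat"
    unfolding Sat_def by (intro open_r open_vimage continuous_s)
  \<comment> \<open>Composing with an arrow that starts in \<open>Sat\<close> changes the range but
    keeps the source in \<open>U\<close>.\<close>
  moreover have "groupoid_invariant r s Sat"
    unfolding groupoid_invariant_def Sat_def by (smt (verit) imageE imageI r_mult s_mult vimage_eq)
  moreover have "x \<notin> Sat"
  proof
    assume "x \<in> Sat"
    then obtain \<eta> where \<eta>: "r \<eta> = x" "s \<eta> \<in> U"
      unfolding Sat_def by auto
    then obtain \<gamma> where \<gamma>: "s \<gamma> = s \<eta>" "4 * M < normsq (c \<gamma>)"
      unfolding U_def by auto
    \<comment> \<open>Both this inverse and its product with \<gamma> have source \<open>x\<close>,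
      and the cocycle identity expresses \<open>c \<gamma>\<close> through their two bounded
      values.\<close>
    let ?\<eta>' = "ginv \<eta>"
    have comp: "s \<gamma> = r ?\<eta>'" "s ?\<eta>' = x"
      using \<gamma>(1) \<eta>(1) by (simp_all add: r_inv s_inv)
    then have "c (gmult \<gamma> ?\<eta>') = add (c \<gamma>) (L \<gamma> (c ?\<eta>'))"
      by (simp add: c_mult)
    moreover have "add (L \<gamma> (c ?\<eta>')) (c \<gamma>) = add (c \<gamma>) (L \<gamma> (c ?\<eta>'))"
      using comp by (intro fibre.add_commute[of _ "r \<gamma>"]) auto
    ultimately have "c \<gamma> = diff (c (gmult \<gamma> ?\<eta>')) (L \<gamma> (c ?\<eta>'))"
      using comp by (intro fibre.diff_unique[of _ "r \<gamma>"]) (auto simp: r_mult)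
    then have "normsq (c \<gamma>) \<le> 2 * normsq (c (gmult \<gamma> ?\<eta>')) + 2 * normsq (L \<gamma> (c ?\<eta>'))"
      using comp fibre.normsq_diff_le[of "c (gmult \<gamma> ?\<eta>')" "r \<gamma>" "L \<gamma> (c ?\<eta>')"]
      by (simp add: r_mult)
    moreover have "normsq (c (gmult \<gamma> ?\<eta>')) \<le> M"
      using comp by (intro M) (simp add: s_mult)
    moreover have "normsq (L \<gamma> (c ?\<eta>')) \<le> M"
      using M[OF comp(2)] comp by (simp add: normsq_action)
    ultimately show False
      using \<gamma>(2) by linarith
  qed
  ultimately have "Sat = {}"
    using minimal unfolding groupoid_minimal_def by blast
  \<comment> \<open>Units join each point of \<open>U\<close> to itself.\<close>
  moreover have "U \<subseteq> Sat"
    unfolding Sat_def by (metis image_eqI r_unit s_unit subsetI vimageI2)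
  ultimately have "\<And>\<gamma>. normsq (c \<gamma>) \<le> 4 * M"
    unfolding U_def by (simp add: image_subset_iff subset_iff not_less)
  then show ?thesis
    unfolding bounded_norm_iff by blast
qed

section \<open>Barycentres and variances of dyadic measures on the cocycle values\<close>

text \<open>\<open>spread b v\<close> says that \<open>b\<close> is the barycentre and \<open>v\<close> the variance of some dyadic
  probability measure of finite support on \<open>{c \<gamma> | \<gamma>. r \<gamma> = p b}\<close>.\<close>

inductive spread :: "'e \<Rightarrow> real \<Rightarrow> bool" where
  spread_point: "spread (c \<gamma>) 0"
| spread_mid: "spread a u \<Longrightarrow> spread b v \<Longrightarrow> p a = p b \<Longrightarrow>
    spread (mid a b) ((u + v) / 2 + normsq (diff a b) / 4)"

text \<open>The affine maps send cocycle values to cocycle values and preserve midpoints and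
  distances, hence every step of the construction.\<close>

lemma spread_affine:
  assumes "spread b v" "p b = s \<gamma>"
  shows "spread (affine_action \<gamma> b) v"
  using assms
proof induction
  case (spread_point \<gamma>')
  then show ?case
    by (simp add: affine_c spread.spread_point)
next
  case (spread_mid a u b v)
  then have "p a = s \<gamma>" "p b = s \<gamma>"
    using proj_mid by metis+
  with spread_mid show ?case
    using spread.spread_mid[of "affine_action \<gamma> a" u "affine_action \<gamma> b" v]
    by (simp add: mid_affine normsq_diff_affine)
qed

text \<open>Variance plus squared norm of the barycentre is the second moment, an average of values
  \<open>normsq (c \<gamma>)\<close>; by the parallelogram law it averages under
  \<open>spread_mid\<close>.\<close>

lemma spread_bound:
  assumes "spread b v" "\<And>\<gamma>. normsq (c \<gamma>) \<le> M"
  shows "v + normsq b \<le> M"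
  using assms(1)
proof induction
  case (spread_mid a u b v)
  then show ?case
    using fibre.normsq_mid[of a "p b" b] by (simp add: field_simps)
qed (simp add: assms(2))

text \<open>A single value moves to nearby fibres because \<open>r\<close> is open and
  \<open>c\<close> is continuous; midpoints and differences then follow continuously. The induction
  generalises \<open>W\<close> and \<open>t\<close> because the two halves need smaller
  neighbourhoods and other thresholds.\<close>

lemma spread_perturb:
  assumes "spread b v" "open W" "b \<in> W" "t < v"
  shows "\<exists>O'. open O' \<and> p b \<in> O' \<and> (\<forall>y\<in>O'. \<exists>b' v'. spread b' v' \<and> p b' = y \<and> b' \<in> W \<and> t < v')"
  using assms
proof (induction arbitrary: W t)
  case (spread_point \<gamma>)
  have "open (r ` (c -` W))"
    using spread_point by (intro open_r open_vimage continuous_c)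
  moreover have "r \<gamma> \<in> r ` (c -` W)"
    using spread_point by simp
  moreover have "\<exists>b' v'. spread b' v' \<and> p b' = y \<and> b' \<in> W \<and> t < v'" if "y \<in> r ` (c -` W)" for y
    using that spread_point by (metis imageE proj_c spread.spread_point vimageE)
  ultimately show ?case
    using proj_c by metis
next
  case (spread_mid a u b v)
  let ?N = "normsq (diff a b)"
  \<comment> \<open>The slack above \<open>t\<close>. Each half may lose \<open>g / 2\<close> of
    variance and the squared distance may lose \<open>2 * g\<close>; in the variance of the midpoint
    each loss counts \<open>g / 2\<close>, in total \<open>g\<close>.\<close>
  define g where "g = (u + v) / 2 + ?N / 4 - t"
  have "g > 0"
    using spread_mid.prems by (simp add: g_def)
  obtain A1 B1 where AB1: "open A1" "open B1" "a \<in> A1" "b \<in> B1"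
    "\<And>a' b'. a' \<in> A1 \<Longrightarrow> b' \<in> B1 \<Longrightarrow> p a' = p b' \<Longrightarrow> mid a' b' \<in> W"
    using open_mid_nhds[OF spread_mid.prems(1,2) \<open>p a = p b\<close>] by blast
  have "diff a b \<in> {w. ?N - 2 * g < normsq w}"
    using \<open>g > 0\<close> by simp
  then obtain A2 B2 where AB2: "open A2" "open B2" "a \<in> A2" "b \<in> B2"
    "\<And>a' b'. a' \<in> A2 \<Longrightarrow> b' \<in> B2 \<Longrightarrow> p a' = p b' \<Longrightarrow> diff a' b' \<in> {w. ?N - 2 * g < normsq w}"
    using open_diff_nhds[OF open_normsq_gt _ \<open>p a = p b\<close>] by blast
  obtain P where P: "open P" "p a \<in> P"
    "\<And>y. y \<in> P \<Longrightarrow> \<exists>a' u'. spread a' u' \<and> p a' = y \<and> a' \<in> A1 \<inter> A2 \<and> u - g / 2 < u'"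
    using spread_mid.IH(1)[of "A1 \<inter> A2" "u - g / 2"] AB1(1,3) AB2(1,3) \<open>g > 0\<close>
    by (metis IntI diff_less_eq half_gt_zero less_add_same_cancel1 open_Int)
  obtain Q where Q: "open Q" "p b \<in> Q"
    "\<And>y. y \<in> Q \<Longrightarrow> \<exists>b' v'. spread b' v' \<and> p b' = y \<and> b' \<in> B1 \<inter> B2 \<and> v - g / 2 < v'"
    using spread_mid.IH(2)[of "B1 \<inter> B2" "v - g / 2"] AB1(2,4) AB2(2,4) \<open>g > 0\<close>
    by (metis IntI diff_less_eq half_gt_zero less_add_same_cancel1 open_Int)
  have "\<exists>m w. spread m w \<and> p m = y \<and> m \<in> W \<and> t < w" if y: "y \<in> P \<inter> Q" for y
  proof -
    obtain a' u' where a': "spread a' u'" "p a' = y" "a' \<in> A1" "a' \<in> A2" "u - g / 2 < u'"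
      using P(3)[of y] y by blast
    obtain b' v' where b': "spread b' v'" "p b' = y" "b' \<in> B1" "b' \<in> B2" "v - g / 2 < v'"
      using Q(3)[of y] y by blast
    have "?N - 2 * g < normsq (diff a' b')"
      using AB2(5) a' b' by auto
    then have "t < (u' + v') / 2 + normsq (diff a' b') / 4"
      using a'(5) b'(5) unfolding g_def by (simp add: field_simps)
    moreover have "spread (mid a' b') ((u' + v') / 2 + normsq (diff a' b') / 4)"
      using a' b' by (intro spread.spread_mid) auto
    moreover have "mid a' b' \<in> W"
      using AB1(5) a' b' by auto
    ultimately show ?thesis
      using a'(2) b'(2) proj_mid by blast
  qed
  moreover have "p (mid a b) \<in> P \<inter> Q"
    using P(2) Q(2) \<open>p a = p b\<close> by simp
  moreover have "open (P \<inter> Q)"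
    using P(1) Q(1) by (rule open_Int)
  ultimately show ?case
    by blast
qed

text \<open>Minimality makes the supremum of the variances the same in every fibre, because each set
  of points admitting a variance above \<open>t\<close> is open and invariant.\<close>

lemma spread_levels:
  assumes "groupoid_minimal r s" "\<And>\<gamma>. normsq (c \<gamma>) \<le> M"
  obtains V where "\<And>b v. spread b v \<Longrightarrow> v \<le> V"
    "\<And>x t. t < V \<Longrightarrow> \<exists>b v. spread b v \<and> p b = x \<and> t < v"
proof -
  let ?S = "{v. \<exists>b. spread b v}"
  define V where "V = Sup ?S"
  have "v \<le> M" if "spread b v" for b v
    using spread_bound[OF that assms(2)] by (smt (verit) zero_le_power2)
  then have bdd: "bdd_above ?S"
    by (auto simp: bdd_above_def)
  have "?S \<noteq> {}"
    using spread_point by blast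
  define U where "U t = {x. \<exists>b v. spread b v \<and> p b = x \<and> t < v}" for t
  have "open (U t)" for t
    unfolding open_subopen[of "U t"]
  proof
    fix x
    assume "x \<in> U t"
    then obtain b v where b: "spread b v" "p b = x" "t < v"
      unfolding U_def by blast
    \<comment> \<open>Only the variance matters here, so the barycentre is left free in
      \<open>UNIV\<close>.\<close>
    obtain O' where "open O'" "p b \<in> O'"
      "\<forall>y\<in>O'. \<exists>b' v'. spread b' v' \<and> p b' = y \<and> b' \<in> UNIV \<and> t < v'"
      using spread_perturb[OF b(1) open_UNIV UNIV_I b(3)] by auto
    then show "\<exists>T. open T \<and> x \<in> T \<and> T \<subseteq> U t"
      using b(2) unfolding U_def by (intro exI[of _ O']) auto
  qed
  moreover have "groupoid_invariant r s (U t)" for t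
    unfolding groupoid_invariant_def U_def using spread_affine proj_affine by blast
  ultimately have U: "U t = {} \<or> U t = UNIV" for t
    using assms(1) unfolding groupoid_minimal_def by blast
  have "\<exists>b v. spread b v \<and> p b = x \<and> t < v" if "t < V" for x t
  proof -
    have "U t \<noteq> {}"
      using that less_cSup_iff[OF \<open>?S \<noteq> {}\<close> bdd] unfolding V_def U_def by blast
    then have "x \<in> U t"
      using U[of t] by blast
    then show ?thesis
      unfolding U_def by simp
  qed
  moreover have "v \<le> V" if "spread b v" for b v
    unfolding V_def using that bdd by (auto intro: cSup_upper)
  ultimately show ?thesis
    using that by blast
qed

section \<open>Chebyshev centres as a continuous section fixed by the affine action\<close>

lemma bounded_imp_coboundary:
  assumes "groupoid_minimal r s" "bounded {ip_norm ip (c \<gamma>) | \<gamma>. True}"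
  shows "continuous_coboundary r s p add smul L c"
proof -
  obtain M where "\<And>\<gamma>. normsq (c \<gamma>) \<le> M"
    using assms(2) unfolding bounded_norm_iff by blast
  then obtain V where V: "\<And>b v. spread b v \<Longrightarrow> v \<le> V"
    "\<And>x t. t < V \<Longrightarrow> \<exists>b v. spread b v \<and> p b = x \<and> t < v"
    using spread_levels[OF assms(1)] by blast
  \<comment> \<open>The variance of the averaged measure is at most \<open>V\<close>; solve for the
    squared distance.\<close>
  have dist: "normsq (diff a b) \<le> 2 * (V - u) + 2 * (V - v)"
    if "spread a u" "spread b v" "p a = p b" for a u b v
    using V(1)[OF spread_mid[OF that]] by (simp add: field_simps)

  \<comment> \<open>Testing against all barycentres of the fibre makes the notion independent of any
    approximating sequence. The factor 4 is the 2 from \<open>dist\<close> times the 2 from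
    \<open>normsq_diff_triangle\<close>.\<close>
  define center where
    "center l \<longleftrightarrow> (\<forall>b v. spread b v \<longrightarrow> p b = p l \<longrightarrow> normsq (diff b l) \<le> 4 * (V - v))" for l
  have center_exists: "\<exists>l. p l = x \<and> center l" for x
  proof -
    \<comment> \<open>\<open>Suc n\<close> keeps the gap positive at \<open>n = 0\<close>, where
      \<open>1 / real n\<close> would be 0.\<close>
    have "\<forall>n. \<exists>b v. spread b v \<and> p b = x \<and> V - 1 / real (Suc n) < v"
      using V(2) by simp
    then obtain B w where B: "\<And>n. spread (B n) (w n)" "\<And>n. p (B n) = x"
      "\<And>n. V - 1 / real (Suc n) < w n"
      by metis
    have gap: "(\<lambda>n. V - w n) \<longlonglongrightarrow> 0"
    proof (rule tendsto_sandwich)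
      show "\<forall>\<^sub>F n in sequentially. 0 \<le> V - w n"
        using V(1)[OF B(1)] by simp
      show "\<forall>\<^sub>F n in sequentially. V - w n \<le> 1 / real (Suc n)"
        using B(3) by (intro always_eventually allI) (smt (verit))
      show "(\<lambda>n. 1 / real (Suc n)) \<longlonglongrightarrow> 0"
        by (rule LIMSEQ_Suc[OF lim_1_over_n])
    qed auto
    have "(\<lambda>n. 2 * (V - w n)) \<longlonglongrightarrow> 0"
      using tendsto_mult_left[OF gap, of 2] by simp
    then obtain l where l: "p l = x" "(\<lambda>n. normsq (diff (B n) l)) \<longlonglongrightarrow> 0"
      using fibre.normsq_complete[of B x "\<lambda>n. 2 * (V - w n)"] dist B by auto
    \<comment> \<open>Compare \<open>b\<close> with \<open>l\<close> through \<open>B n\<close>, and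
      let \<open>n\<close> tend to infinity.\<close>
    have "normsq (diff b l) \<le> 4 * (V - v)" if "spread b v" "p b = x" for b v
    proof (rule LIMSEQ_le_const)
      show "(\<lambda>n. 4 * (V - v) + 4 * (V - w n) + 2 * normsq (diff (B n) l)) \<longlonglongrightarrow> 4 * (V - v)"
        using tendsto_add[OF tendsto_add[OF tendsto_const tendsto_mult_left[OF gap, of 4]]
            tendsto_mult_left[OF l(2), of 2], of "4 * (V - v)"] by simp
      have "normsq (diff b l) \<le> 4 * (V - v) + 4 * (V - w n) + 2 * normsq (diff (B n) l)" for n
        using fibre.normsq_diff_triangle[of b x "B n" l] dist[OF that(1) B(1), of n] that(2) B(2) l(1)
        by simp
      then show "\<exists>N. \<forall>n\<ge>N. normsq (diff b l)
          \<le> 4 * (V - v) + 4 * (V - w n) + 2 * normsq (diff (B n) l)"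
        by blast
    qed
    then show ?thesis
      using l(1) unfolding center_def by blast
  qed
  have center_unique: "l = l'" if "center l" "center l'" "p l = p l'" for l l'
  proof -
    \<comment> \<open>A barycentre of nearly maximal variance is close to both centres. The 16 below
      is 2 times 4 for each of the two; \<open>0 + e\<close> is the form that
      \<open>field_le_epsilon\<close> expects.\<close>
    have "normsq (diff l l') \<le> 0 + e" if "e > 0" for e
    proof -
      obtain b v where b: "spread b v" "p b = p l" "V - e / 16 < v"
        using V(2)[of "V - e / 16" "p l"] \<open>e > 0\<close> by auto
      have "normsq (diff l l') \<le> 2 * normsq (diff b l) + 2 * normsq (diff b l')"
        using fibre.normsq_diff_triangle[of l "p l" b l'] fibre.normsq_diff_commute[of l "p l" b]
          b(2) \<open>p l = p l'\<close> by simp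
      moreover have "normsq (diff b l) \<le> 4 * (V - v)" "normsq (diff b l') \<le> 4 * (V - v)"
        using \<open>center l\<close> \<open>center l'\<close> b \<open>p l = p l'\<close> unfolding center_def by auto
      ultimately have "normsq (diff l l') \<le> 16 * (V - v)"
        by linarith
      also have "\<dots> \<le> 0 + e"
        using b(3) by (simp add: field_simps)
      finally show ?thesis .
    qed
    then have "normsq (diff l l') \<le> 0"
      by (rule field_le_epsilon)
    then have "normsq (diff l l') = 0"
      by simp
    then have zero: "diff l l' = zero (p l')"
      using fibre.normsq_eq_0[of "diff l l'" "p l'"] that(3) by simp
    have "l = add l' (diff l l')"
      by (rule fibre.add_diff_cancel[of _ "p l'", symmetric]) (simp_all add: that(3))
    also have "\<dots> = l'"
      unfolding zero by (rule fibre.add_zero) simp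
    finally show ?thesis .
  qed
  have center_affine: "center (affine_action \<gamma> l)" if "center l" "p l = s \<gamma>" for \<gamma> l
    unfolding center_def
  proof (intro allI impI)
    fix b v
    assume b: "spread b v" "p b = p (affine_action \<gamma> l)"
    \<comment> \<open>Pull the test measure back to the fibre of \<open>l\<close>, where the
      estimate is known; the action is isometric.\<close>
    let ?b' = "affine_action (ginv \<gamma>) b"
    have pb: "p b = r \<gamma>"
      using b(2) that(2) by simp
    then have b': "spread ?b' v" "p ?b' = s \<gamma>"
      using spread_affine[OF b(1), of "ginv \<gamma>"] by (simp_all add: s_inv r_inv)
    have "normsq (diff b (affine_action \<gamma> l)) = normsq (diff ?b' l)"
      using normsq_diff_affine[OF b'(2) that(2)] affine_affine_inv[OF pb] by simp
    also have "\<dots> \<le> 4 * (V - v)"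
      using that b' unfolding center_def by auto
    finally show "normsq (diff b (affine_action \<gamma> l)) \<le> 4 * (V - v)" .
  qed

  obtain f where f: "\<And>x. p (f x) = x" "\<And>x. center (f x)"
    using center_exists by metis
  \<comment> \<open>Both sides are centres over \<open>r \<gamma>\<close>.\<close>
  have f_affine: "f (r \<gamma>) = affine_action \<gamma> (f (s \<gamma>))" for \<gamma>
    by (rule center_unique) (simp_all add: f center_affine)
  have "c \<gamma> = diff (f (r \<gamma>)) (L \<gamma> (f (s \<gamma>)))" for \<gamma>
  proof (rule fibre.diff_unique)
    show "add (L \<gamma> (f (s \<gamma>))) (c \<gamma>) = f (r \<gamma>)"
      using f_affine by (simp add: affine_action_def)
  qed (auto simp: f)
  moreover have "continuous_on UNIV f"
    unfolding continuous_on_topological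
  proof (intro ballI allI impI)
    fix x W
    assume W: "open W" "f x \<in> W"
    obtain A \<epsilon> where A: "open A" "f x \<in> A" "\<epsilon> > 0"
      "\<And>u' v. u' \<in> A \<Longrightarrow> p v = p u' \<Longrightarrow> normsq (diff v u') < \<epsilon> \<Longrightarrow> v \<in> W"
      using tube_nhds[OF W] by blast
    \<comment> \<open>Two nested tubes: the inner one puts the barycentre near \<open>f x\<close>
      into \<open>A\<close>, and the outer one brings \<open>f y\<close> from a barycentre in
      \<open>A\<close> into \<open>W\<close>.\<close>
    obtain A' \<delta> where A': "open A'" "f x \<in> A'" "\<delta> > 0"
      "\<And>u' v. u' \<in> A' \<Longrightarrow> p v = p u' \<Longrightarrow> normsq (diff v u') < \<delta> \<Longrightarrow> v \<in> A"
      using tube_nhds[OF A(1,2)] by blast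
    \<comment> \<open>A variance above this level places the centre within both \<epsilon> and
      \<delta> of the barycentre, in squared distance.\<close>
    let ?t = "V - min \<epsilon> \<delta> / 4"
    have "?t < V"
      using A(3) A'(3) by simp
    then obtain b v where b: "spread b v" "p b = x" "?t < v"
      using V(2) by blast
    have "normsq (diff b (f x)) \<le> 4 * (V - v)"
      using f b unfolding center_def by auto
    then have "b \<in> A"
      using b f A'(2) by (intro A'(4)[of "f x"]) auto
    \<comment> \<open>As \<open>V\<close> is common to all fibres, the moved measure is still nearly
      maximal over \<open>y\<close>, so its barycentre is close to \<open>f y\<close>.\<close>
    then obtain O' where O': "open O'" "p b \<in> O'"
      "\<And>y. y \<in> O' \<Longrightarrow> \<exists>b' v'. spread b' v' \<and> p b' = y \<and> b' \<in> A \<and> ?t < v'"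
      using spread_perturb[OF b(1) A(1) _ b(3)] by blast
    have "f y \<in> W" if y: "y \<in> O'" for y
    proof -
      obtain b' v' where b': "spread b' v'" "p b' = y" "b' \<in> A" "?t < v'"
        using O'(3)[OF y] by blast
      have "normsq (diff (f y) b') = normsq (diff b' (f y))"
        using fibre.normsq_diff_commute[of "f y" y b'] f(1) b'(2) by simp
      also have "\<dots> \<le> 4 * (V - v')"
        using f b' unfolding center_def by auto
      also have "\<dots> < \<epsilon>"
        using b'(4) by simp
      finally show ?thesis
        using A(4) b' f(1) by simp
    qed
    then show "\<exists>A. open A \<and> x \<in> A \<and> (\<forall>y\<in>UNIV. y \<in> A \<longrightarrow> f y \<in> W)"
      using O'(1,2) b(2) by blast
  qed
  ultimately show ?thesis
    using f(1) unfolding continuous_coboundary_def continuous_section_def by blast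
qed

end

theorem theorem1p3:
  fixes r s :: "'g::topological_space \<Rightarrow> 'x::topological_space"
    and unit_of :: "'x \<Rightarrow> 'g"
    and gmult :: "'g \<Rightarrow> 'g \<Rightarrow> 'g"
    and ginv :: "'g \<Rightarrow> 'g"
    and p :: "'e::topological_space \<Rightarrow> 'x"
    and add :: "'e \<Rightarrow> 'e \<Rightarrow> 'e"
    and zero :: "'x \<Rightarrow> 'e"
    and smul :: "complex \<Rightarrow> 'e \<Rightarrow> 'e"
    and ip :: "'e \<Rightarrow> 'e \<Rightarrow> complex"
    and L :: "'g \<Rightarrow> 'e \<Rightarrow> 'e"
    and c :: "'g \<Rightarrow> 'e"
  assumes "topological_groupoid r s unit_of gmult ginv"
    and "locally_compact_locally_Hausdorff (euclidean :: 'g topology)"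
    and "groupoid_minimal r s"
    and "compact_space (euclidean :: 'x topology)"
    and "metrizable_space (euclidean :: 'x topology)"
    and "G_hilbert_bundle r s unit_of gmult ginv p add zero smul ip L"
    and "continuous_cocycle r s gmult p add L c"
    and "second_countable (euclidean :: 'e topology)"
  shows "(continuous_coboundary r s p add smul L c \<longleftrightarrow>
            (\<exists>x. bounded {ip_norm ip (c \<gamma>) | \<gamma>. s \<gamma> = x})) \<and>
         ((\<exists>x. bounded {ip_norm ip (c \<gamma>) | \<gamma>. s \<gamma> = x}) \<longleftrightarrow>
            bounded {ip_norm ip (c \<gamma>) | \<gamma>. True})"
proof -
  interpret G_hilbert_bundle r s unit_of gmult ginv p add zero smul ip L
    by (rule assms(6))
  interpret bundle_cocycle r s unit_of gmult ginv p add zero smul ip L c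
    using assms(7) by unfold_locales
  have "compact (UNIV :: 'x set)"
    using assms(4) by (simp add: compact_space_def)
  then have "continuous_coboundary r s p add smul L c \<Longrightarrow> bounded {ip_norm ip (c \<gamma>) | \<gamma>. True}"
    by (rule coboundary_bounded)
  moreover have "bounded {ip_norm ip (c \<gamma>) | \<gamma>. True} \<Longrightarrow> continuous_coboundary r s p add smul L c"
    by (rule bounded_imp_coboundary[OF assms(3)])
  moreover have "bounded {ip_norm ip (c \<gamma>) | \<gamma>. s \<gamma> = x} \<Longrightarrow> bounded {ip_norm ip (c \<gamma>) | \<gamma>. True}" for x
    by (rule bounded_fibre_imp_bounded[OF assms(3)])
  \<comment> \<open>The point \<open>x\<close> is arbitrary; one exists because the unit space is a
    whole type, hence nonempty.\<close>
  moreover have "bounded {ip_norm ip (c \<gamma>) | \<gamma>. True} \<Longrightarrow> bounded {ip_norm ip (c \<gamma>) | \<gamma>. s \<gamma> = x}" for x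
    by (rule bounded_subset) auto
  ultimately show ?thesis
    by blast
qed

end
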